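(* Let $S$ be a finite set of pairwise disjoint closed line segments in the Euclidean plane $\mathbb{R}^2$ in general position. For $1\le \beta<\infty$ let $G_\beta(S)$ and $G^c_\beta(S)$ denote the lune-based and the circle-based $\beta$-skeleton of $S$, let $\mathit{GG}(S)=G_1(S)=G^c_1(S)$ be the Gabriel graph of $S$, and let $\mathit{DT}(S)$ be the graph of the segment Delaunay triangulation of $S$. Then for all $1\le\beta<\beta'<\infty$ the following inclusions of edge sets (all graphs having vertex set $S$) hold: $$G_{\beta'}(S)\subseteq G_{\beta}(S)\subseteq \mathit{GG}(S)\subseteq \mathit{DT}(S)$$ and $$G^c_{\beta'}(S)\subseteq G^c_{\beta}(S)\subseteq \mathit{GG}(S)\subseteq \mathit{DT}(S).$$
   Context: $d$ is the Euclidean distance in the plane. General position: no three endpoints of segments of $S$ are collinear, and no circle is tangent to four segments of $S$, where a circle is tangent to a segment $s$ if $s$ intersects the circle but not its interior. Neighborhoods. Let $v'\ne v''$ be points of the plane and $1\le\beta<\infty$. - $N(v',v'',\beta)$ (the lune) is the intersection of the two discs of radius $\frac{\beta d(v',v'')}{2}$ centered at $\frac{\beta}{2}v'+(1-\frac{\beta}{2})v''$ and at $(1-\frac{\beta}{2})v'+\frac{\beta}{2}v''$. - $N^c(v',v'',\beta)$ is the union of the two discs of radius $\frac{\beta d(v',v'')}{2}$ having the segment $v'v''$ as a chord. For $\beta=1$ both are the disc with diameter $v'v''$. The discs may be taken all closed or all open (giving closed or open $\beta$-skeletons); one convention is used consistently for all the skeletons in the statement. $\beta$-skeletons of segments. $G_\beta(S)$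 (respectively $G^c_\beta(S)$) is the graph with vertex set $S$ in which distinct $s',s''\in S$ are joined by an edge iff there exist points $v'\in s'$, $v''\in s''$ such that no segment $s\in S\setminus\{s',s''\}$ intersects $N(v',v'',\beta)$ (respectively $N^c(v',v'',\beta)$). Segment Delaunay triangulation. A segment triangulation $P$ of $S$ is a partition of the convex hull $\mathrm{conv}(S)$ into disjoint sites (the segments of $S$), edges and faces such that: every face is an open triangle whose vertices belong to three distinct segments of $S$ and whose open edges do not intersect $S$; no face can be added without intersecting another one; and the edges of $P$ are the (possibly two-dimensional) connected components of $\mathrm{conv}(S)\setminus(F\cup S)$, where $F$ is the set (union) of faces of $P$. The segment Delaunay triangulation is the segment triangulation in which the interior of the circumcircle of each triangular face does not intersect $S$. $\mathit{DT}(S)$ is the corresponding planar (multi)graph: its vertices are the segments of $S$, and each edge of $P$ gives an edge joining the two segments it connects; it is the dual graph of the (Euclidean) Voronoi diagram of the set of segments $S$. For the inclusion $\mathit{GG}(S)\subseteq\mathit{DT}(S)$, multiplicities of edges are ignored: it means that every pair of segments adjacent in $\mathit{GG}(S)$ is adjacent in $\mathit{DT}(S)$. *)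

theory Defs
  imports "HOL-Analysis.Analysis"
begin

type_synonym point = "real^2"

(* A segment is represented by its set of points; one reduced to a single point is allowed. *)
definition is_segment :: "point set \<Rightarrow> bool" where
  "is_segment s \<longleftrightarrow> (\<exists>a b. s = closed_segment a b)"

definition endpoints :: "point set set \<Rightarrow> point set" where
  "endpoints S = {a. \<exists>b. closed_segment a b \<in> S}"

definition tangent :: "point \<Rightarrow> real \<Rightarrow> point set \<Rightarrow> bool" where
  "tangent z r s \<longleftrightarrow> s \<inter> sphere z r \<noteq> {} \<and> s \<inter> ball z r = {}"

definition general_position :: "point set set \<Rightarrow> bool" where
  "general_position S \<longleftrightarrow>
     (\<forall>A \<subseteq> endpoints S. card A = 3 \<longrightarrow> \<not> collinear A) \<and>
     \<not> (\<exists>z r. r > 0 \<and> (\<exists>Q \<subseteq> S. card Q = 4 \<and> (\<forall>s\<in>Q. tangent z r s)))"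


(* The argument disc is the common convention for all discs: ball (open) or cball (closed). *)
definition lune :: "(point \<Rightarrow> real \<Rightarrow> point set) \<Rightarrow> real \<Rightarrow> point \<Rightarrow> point \<Rightarrow> point set" where
  "lune disc \<beta> v w =
     disc ((\<beta>/2) *\<^sub>R v + (1 - \<beta>/2) *\<^sub>R w) (\<beta> * dist v w / 2) \<inter>
     disc ((1 - \<beta>/2) *\<^sub>R v + (\<beta>/2) *\<^sub>R w) (\<beta> * dist v w / 2)"

(* For v \<noteq> w there are two admissible centres z when \<beta> > 1, and they coincide when \<beta> = 1. *)
definition two_discs :: "(point \<Rightarrow> real \<Rightarrow> point set) \<Rightarrow> real \<Rightarrow> point \<Rightarrow> point \<Rightarrow> point set" where
  "two_discs disc \<beta> v w =
     (\<Union>z \<in> {z. dist z v = \<beta> * dist v w / 2 \<and> dist z w = \<beta> * dist v w / 2}.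
        disc z (\<beta> * dist v w / 2))"

definition skeleton :: "(point \<Rightarrow> point \<Rightarrow> point set) \<Rightarrow> point set set \<Rightarrow> point set set set" where
  "skeleton N S =
     {{s, t} | s t. s \<in> S \<and> t \<in> S \<and> s \<noteq> t \<and>
        (\<exists>v\<in>s. \<exists>w\<in>t. \<forall>u \<in> S - {s, t}. u \<inter> N v w = {})}"

definition lune_skeleton ::
    "(point \<Rightarrow> real \<Rightarrow> point set) \<Rightarrow> real \<Rightarrow> point set set \<Rightarrow> point set set set" where
  "lune_skeleton disc \<beta> S = skeleton (lune disc \<beta>) S"

definition circle_skeleton ::
    "(point \<Rightarrow> real \<Rightarrow> point set) \<Rightarrow> real \<Rightarrow> point set set \<Rightarrow> point set set set" where
  "circle_skeleton disc \<beta> S = skeleton (two_discs disc \<beta>) S"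

definition gabriel_graph ::
    "(point \<Rightarrow> real \<Rightarrow> point set) \<Rightarrow> point set set \<Rightarrow> point set set set" where
  "gabriel_graph disc S = lune_skeleton disc 1 S"


definition open_triangle :: "point \<Rightarrow> point \<Rightarrow> point \<Rightarrow> point set" where
  "open_triangle a b c = interior (convex hull {a, b, c})"

definition is_face :: "point set set \<Rightarrow> point set \<Rightarrow> bool" where
  "is_face S T \<longleftrightarrow>
     (\<exists>a b c s1 s2 s3. \<not> collinear {a, b, c} \<and> T = open_triangle a b c \<and>
        s1 \<in> S \<and> s2 \<in> S \<and> s3 \<in> S \<and> s1 \<noteq> s2 \<and> s1 \<noteq> s3 \<and> s2 \<noteq> s3 \<and>
        a \<in> s1 \<and> b \<in> s2 \<and> c \<in> s3 \<and>
        (open_segment a b \<union> open_segment b c \<union> open_segment c a) \<inter> \<Union>S = {}) \<and>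
     T \<inter> \<Union>S = {}"

(* A segment triangulation is given by its set F of faces; sites and faces determine the edges,
   and faces lie in the convex hull of \<Union>S automatically. *)
definition segment_triangulation :: "point set set \<Rightarrow> point set set \<Rightarrow> bool" where
  "segment_triangulation S F \<longleftrightarrow>
     (\<forall>T\<in>F. is_face S T) \<and> pairwise disjnt F \<and>
     (\<forall>T. is_face S T \<and> T \<notin> F \<longrightarrow> (\<exists>T'\<in>F. T \<inter> T' \<noteq> {}))"

definition triangulation_edges :: "point set set \<Rightarrow> point set set \<Rightarrow> point set set" where
  "triangulation_edges S F = components (convex hull (\<Union>S) - (\<Union>F \<union> \<Union>S))"

definition segment_delaunay_triangulation :: "point set set \<Rightarrow> point set set \<Rightarrow> bool" where
  "segment_delaunay_triangulation S F \<longleftrightarrow> segment_triangulation S F \<and>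
     (\<forall>a b c z r. \<not> collinear {a, b, c} \<and> open_triangle a b c \<in> F \<and>
        dist z a = r \<and> dist z b = r \<and> dist z c = r \<longrightarrow> ball z r \<inter> \<Union>S = {})"

(* An edge of the triangulation connects the segments that its closure meets.  Multiplicities are
   ignored: two segments are adjacent if at least one edge connects them. *)
definition triangulation_graph :: "point set set \<Rightarrow> point set set \<Rightarrow> point set set set" where
  "triangulation_graph S F =
     {{s, t} | s t. s \<in> S \<and> t \<in> S \<and> s \<noteq> t \<and>
        (\<exists>e \<in> triangulation_edges S F. closure e \<inter> s \<noteq> {} \<and> closure e \<inter> t \<noteq> {})}"

end

theory Submission
  imports Defs
begin

text \<open>
  Both kinds of neighbourhoods grow with \<open>\<beta>\<close>, which gives the inclusions among skeletons.

  Let \<open>v \<in> s\<close> and \<open>w \<in> t\<close> witness a Gabriel edge.  By the intermediate value theorem some point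
  \<open>z\<close> of the segment \<open>vw\<close> is equidistant from \<open>s\<close> and \<open>t\<close>; the disc about \<open>z\<close> that touches both
  lies in the disc with diameter \<open>vw\<close>, so its interior misses all of \<open>S\<close>.  The chord joining
  the points of contact with \<open>s\<close> and \<open>t\<close> meets no Delaunay face: the difference of the powers of
  a point with respect to this circle and to the circumcircle of the face is an affine function that
  separates the chord from the face, unless the two circles coincide, and then general position makes
  the chord a side of the face.  Hence the chord lies in a single edge of the triangulation.
\<close>

section \<open>Monotonicity of the neighbourhoods\<close>

lemma skeleton_antimono:
  assumes "\<And>v w. N v w \<subseteq> N' v w"
  shows "skeleton N' S \<subseteq> skeleton N S"
proof
  fix e assume "e \<in> skeleton N' S"
  then obtain s t v w where "e = {s, t}" "s \<in> S" "t \<in> S" "s \<noteq> t" "v \<in> s" "w \<in> t"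
    and "\<forall>u \<in> S - {s, t}. u \<inter> N' v w = {}"
    unfolding skeleton_def by blast
  moreover from this have "\<forall>u \<in> S - {s, t}. u \<inter> N v w = {}"
    using assms[of v w] by fast
  ultimately show "e \<in> skeleton N S"
    unfolding skeleton_def by blast
qed

lemma disc_nested:
  assumes "disc = ball \<or> disc = cball" "dist x y \<le> r' - r"
  shows "disc x r \<subseteq> disc y r'"
proof
  fix z assume "z \<in> disc x r"
  then show "z \<in> disc y r'"
    using assms dist_triangle[of y z x] by (auto simp: dist_commute)
qed

text \<open>When \<beta> grows to \<beta>', each centre moves by exactly the amount by which the
  radius grows, so each of the two discs stays inside its successor. The second disc is the first
  with \<open>v\<close> and \<open>w\<close> exchanged.\<close>

lemma lune_mono:
  assumes disc: "disc = ball \<or> disc = cball" and "\<beta> \<le> \<beta>'"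
  shows "lune disc \<beta> v w \<subseteq> lune disc \<beta>' v w"
proof -
  have nested: "disc ((\<beta>/2) *\<^sub>R v + (1 - \<beta>/2) *\<^sub>R w) (\<beta> * dist v w / 2)
      \<subseteq> disc ((\<beta>'/2) *\<^sub>R v + (1 - \<beta>'/2) *\<^sub>R w) (\<beta>' * dist v w / 2)" for v w :: point
  proof (rule disc_nested[OF disc])
    have *: "((\<beta>/2) *\<^sub>R v + (1 - \<beta>/2) *\<^sub>R w) - ((\<beta>'/2) *\<^sub>R v + (1 - \<beta>'/2) *\<^sub>R w)
        = ((\<beta> - \<beta>')/2) *\<^sub>R (v - w)"
      by (simp add: algebra_simps diff_divide_distrib)
    show "dist ((\<beta>/2) *\<^sub>R v + (1 - \<beta>/2) *\<^sub>R w) ((\<beta>'/2) *\<^sub>R v + (1 - \<beta>'/2) *\<^sub>R w)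
        \<le> \<beta>' * dist v w / 2 - \<beta> * dist v w / 2"
      using \<open>\<beta> \<le> \<beta>'\<close> unfolding dist_norm * norm_scaleR by (simp add: field_simps)
  qed
  show ?thesis
    using nested[of v w] nested[of w v] unfolding lune_def
    by (auto simp: dist_commute add.commute)
qed

section \<open>The pencil of circles through two points\<close>

definition rot :: "point \<Rightarrow> point" where
  "rot u = vector [- u$2, u$1]"

lemma inner_real2: "(x::point) \<bullet> y = x$1 * y$1 + x$2 * y$2"
  by (simp add: inner_vec_def sum_2)

lemma inner_rot_self: "rot u \<bullet> u = 0" "rot u \<bullet> rot u = u \<bullet> u"
  by (simp_all add: rot_def inner_real2)

lemma orthogonal_imp_rot:
  assumes "p \<bullet> u = 0" "u \<noteq> 0"
  obtains \<mu> where "p = \<mu> *\<^sub>R rot u"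
proof
  define N where "N = u$1 * u$1 + u$2 * u$2"
  have N: "N \<noteq> 0"
    using assms(2) inner_eq_zero_iff[of u] by (simp add: N_def inner_real2)
  have 0: "p$1 * u$1 + p$2 * u$2 = 0"
    using assms(1) by (simp add: inner_real2)
  \<comment> \<open>The factor in parentheses is the inner product of \<open>p\<close> and
    \<open>rot u\<close>, and \<open>N\<close> is the squared length of \<open>rot u\<close>: the
    coefficient is that of an orthogonal projection.\<close>
  have "p$1 * N = (p$1 * - u$2 + p$2 * u$1) * - u$2" "p$2 * N = (p$1 * - u$2 + p$2 * u$1) * u$1"
    using 0 unfolding N_def by algebra+
  then show "p = ((p$1 * - u$2 + p$2 * u$1) / N) *\<^sub>R rot u"
    using N by (simp add: vec_eq_iff forall_2 rot_def field_simps)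
qed

text \<open>With \<open>p\<close> the offset of \<open>z\<close> from the midpoint and
  \<open>u = w - v\<close>, subtracting the two squared distance conditions makes \<open>p\<close>
  orthogonal to \<open>u\<close>, and adding them gives Pythagoras. The signed parameter \<mu> names
  both centres at once.\<close>

lemma two_discs_centres:
  fixes v w z :: point
  assumes "v \<noteq> w" "1 \<le> \<beta>"
  shows "dist z v = \<beta> * dist v w / 2 \<and> dist z w = \<beta> * dist v w / 2 \<longleftrightarrow>
    (\<exists>\<mu>. \<mu>\<^sup>2 = (\<beta>\<^sup>2 - 1) / 4 \<and> z = midpoint v w + \<mu> *\<^sub>R rot (w - v))"
    (is "?L \<longleftrightarrow> ?R")
proof -
  define u p where "u = w - v" and "p = z - midpoint v w"
  have u: "u \<noteq> 0" using assms by (simp add: u_def)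
  have zv: "z - v = p + (1/2) *\<^sub>R u" and zw: "z - w = p - (1/2) *\<^sub>R u"
    by (simp_all add: u_def p_def midpoint_def vec_eq_iff field_simps)
  have sq: "dist z x = \<beta> * dist v w / 2 \<longleftrightarrow> (z - x) \<bullet> (z - x) = \<beta>\<^sup>2 * (u \<bullet> u) / 4" for x
  proof -
    have "dist z x = \<beta> * dist v w / 2 \<longleftrightarrow> (dist z x)\<^sup>2 = (\<beta> * dist v w / 2)\<^sup>2"
      using assms by (intro power2_eq_iff_nonneg[symmetric]) auto
    also have "\<dots> \<longleftrightarrow> (z - x) \<bullet> (z - x) = \<beta>\<^sup>2 * (u \<bullet> u) / 4"
      by (simp add: power_mult_distrib power_divide dist_norm norm_minus_commute[of v]
          power2_norm_eq_inner u_def)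
    finally show ?thesis .
  qed
  have "?L \<longleftrightarrow> p \<bullet> u = 0 \<and> p \<bullet> p = (\<beta>\<^sup>2 - 1) / 4 * (u \<bullet> u)"
    unfolding sq zv zw
    by (auto simp: inner_add_left inner_add_right inner_diff_left inner_diff_right
        inner_commute[of u p] field_simps)
  also have "\<dots> \<longleftrightarrow> (\<exists>\<mu>. \<mu>\<^sup>2 = (\<beta>\<^sup>2 - 1) / 4 \<and> p = \<mu> *\<^sub>R rot u)"
  proof
    assume *: "p \<bullet> u = 0 \<and> p \<bullet> p = (\<beta>\<^sup>2 - 1) / 4 * (u \<bullet> u)"
    then obtain \<mu> where "p = \<mu> *\<^sub>R rot u" using orthogonal_imp_rot u by blast
    then show "\<exists>\<mu>. \<mu>\<^sup>2 = (\<beta>\<^sup>2 - 1) / 4 \<and> p = \<mu> *\<^sub>R rot u"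
      using * u by (auto simp: inner_rot_self power2_eq_square intro!: exI[of _ \<mu>])
  next
    assume "\<exists>\<mu>. \<mu>\<^sup>2 = (\<beta>\<^sup>2 - 1) / 4 \<and> p = \<mu> *\<^sub>R rot u"
    then show "p \<bullet> u = 0 \<and> p \<bullet> p = (\<beta>\<^sup>2 - 1) / 4 * (u \<bullet> u)"
      by (auto simp: inner_rot_self power2_eq_square)
  qed
  also have "\<dots> \<longleftrightarrow> ?R"
    unfolding p_def u_def by (simp add: diff_eq_eq add.commute)
  finally show ?thesis .
qed

text \<open>The left side is the power of \<open>x\<close> with respect to the circle of the pencil
  through \<open>v\<close> and \<open>w\<close> with parameter \<mu>. The terms in \<mu> squared
  cancel, so the power is affine in \<mu>, and the sign of its slope tells the side of the line
  \<open>vw\<close> on which \<open>x\<close> lies.\<close>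

lemma power_two_discs:
  fixes v w x :: point
  shows "(dist (midpoint v w + \<mu> *\<^sub>R rot (w - v)) x)\<^sup>2 - ((4 * \<mu>\<^sup>2 + 1) * (dist v w / 2)\<^sup>2) =
    (dist (midpoint v w) x)\<^sup>2 - (dist v w / 2)\<^sup>2 - 2 * \<mu> * (rot (w - v) \<bullet> (x - midpoint v w))"
proof -
  define u q where "u = w - v" and "q = x - midpoint v w"
  have "dist (midpoint v w + \<mu> *\<^sub>R rot (w - v)) x = norm (\<mu> *\<^sub>R rot u - q)"
    "dist (midpoint v w) x = norm q" "dist v w = norm u"
    by (simp_all add: u_def q_def dist_norm norm_minus_commute algebra_simps)
  then show ?thesis
    unfolding u_def[symmetric] q_def[symmetric]
    by (simp only: power_divide power2_norm_eq_inner inner_diff_left inner_diff_right)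
      (simp add: inner_rot_self inner_commute[of q "rot u"] power2_eq_square field_simps)
qed

text \<open>Covers coincident points, since \<open>skeleton_antimono\<close> compares the
  neighbourhoods of all pairs.\<close>

lemma two_discs_refl: "two_discs disc \<beta> v v = disc v 0"
  by (auto simp: two_discs_def)

text \<open>Single discs need not be nested, but their union grows: pushing the centre farther
  towards the side of \<open>x\<close> cannot increase the power of \<open>x\<close>.\<close>

lemma two_discs_mono:
  assumes disc: "disc = ball \<or> disc = cball" and \<beta>: "1 \<le> \<beta>" "\<beta> \<le> \<beta>'"
  shows "two_discs disc \<beta> v w \<subseteq> two_discs disc \<beta>' v w"
proof (cases "v = w")
  case True
  then show ?thesis by (simp add: two_discs_refl)
next
  case False
  show ?thesis
  proof
    fix x assume "x \<in> two_discs disc \<beta> v w"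
    then obtain \<mu> where \<mu>: "\<mu>\<^sup>2 = (\<beta>\<^sup>2 - 1) / 4"
      and x: "x \<in> disc (midpoint v w + \<mu> *\<^sub>R rot (w - v)) (\<beta> * dist v w / 2)"
      unfolding two_discs_def two_discs_centres[OF False \<beta>(1)] by auto
    define l where "l = rot (w - v) \<bullet> (x - midpoint v w)"
    \<comment> \<open>The sign selects the larger disc whose centre is on the same side of the line
      \<open>vw\<close> as \<open>x\<close>, so that \<open>\<mu>' * l\<close> is as large as
      possible.\<close>
    define \<mu>' where "\<mu>' = (if l \<ge> 0 then 1 else - 1) * sqrt ((\<beta>'\<^sup>2 - 1) / 4)"
    have \<beta>': "1 \<le> \<beta>'" and sq: "1 \<le> \<beta>\<^sup>2" "\<beta>\<^sup>2 \<le> \<beta>'\<^sup>2"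
      using \<beta> by (auto intro: power_mono one_le_power)
    have \<mu>': "\<mu>'\<^sup>2 = (\<beta>'\<^sup>2 - 1) / 4"
      using sq by (simp add: \<mu>'_def power_mult_distrib)
    have "\<bar>\<mu>\<bar> \<le> \<bar>\<mu>'\<bar>"
      using sq unfolding abs_le_square_iff \<mu> \<mu>' by simp
    moreover have "\<mu>' * l = \<bar>\<mu>'\<bar> * \<bar>l\<bar>"
      using sq by (simp add: \<mu>'_def abs_mult)
    moreover have "\<mu> * l \<le> \<bar>\<mu>\<bar> * \<bar>l\<bar>"
      by (metis abs_ge_self abs_mult)
    ultimately have "\<mu> * l \<le> \<mu>' * l"
      using mult_right_mono[of "\<bar>\<mu>\<bar>" "\<bar>\<mu>'\<bar>" "\<bar>l\<bar>"] by linarith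
    moreover have r: "(4 * \<mu>\<^sup>2 + 1) * (dist v w / 2)\<^sup>2 = (\<beta> * dist v w / 2)\<^sup>2"
      "(4 * \<mu>'\<^sup>2 + 1) * (dist v w / 2)\<^sup>2 = (\<beta>' * dist v w / 2)\<^sup>2"
      unfolding \<mu> \<mu>' by (simp_all add: power_mult_distrib power_divide diff_divide_distrib)
    ultimately have le: "(dist (midpoint v w + \<mu>' *\<^sub>R rot (w - v)) x)\<^sup>2 - (\<beta>' * dist v w / 2)\<^sup>2
        \<le> (dist (midpoint v w + \<mu> *\<^sub>R rot (w - v)) x)\<^sup>2 - (\<beta> * dist v w / 2)\<^sup>2"
      using power_two_discs[of v w \<mu> x] power_two_discs[of v w \<mu>' x] by (simp add: l_def)
    have nn: "0 \<le> \<beta> * dist v w / 2" "0 \<le> \<beta>' * dist v w / 2"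
      using \<beta> by simp_all
    have "x \<in> disc (midpoint v w + \<mu>' *\<^sub>R rot (w - v)) (\<beta>' * dist v w / 2)"
      using disc
    proof
      assume b: "disc = ball"
      then have "(dist (midpoint v w + \<mu> *\<^sub>R rot (w - v)) x)\<^sup>2 < (\<beta> * dist v w / 2)\<^sup>2"
        using x by (intro power_strict_mono) auto
      then show ?thesis
        using le power2_less_imp_less[OF _ nn(2)] b by simp
    next
      assume b: "disc = cball"
      then have "(dist (midpoint v w + \<mu> *\<^sub>R rot (w - v)) x)\<^sup>2 \<le> (\<beta> * dist v w / 2)\<^sup>2"
        using x by (intro power_mono) auto
      then show ?thesis
        using le power2_le_imp_le[OF _ nn(2)] b by simp
    qed
    then show "x \<in> two_discs disc \<beta>' v w"
      unfolding two_discs_def two_discs_centres[OF False \<beta>'] using \<mu>' by blast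
  qed
qed

lemma lune_one: "lune disc 1 v w = disc (midpoint v w) (dist v w / 2)"
  by (simp add: lune_def midpoint_def scaleR_add_right)

lemma two_discs_one: "two_discs disc 1 v w = disc (midpoint v w) (dist v w / 2)"
proof (cases "v = w")
  case True
  then show ?thesis by (simp add: two_discs_refl)
next
  case False
  show ?thesis
    unfolding two_discs_def two_discs_centres[OF False order_refl] by simp
qed

section \<open>Empty discs and Delaunay faces\<close>

lemma exists_circumcentre:
  fixes a b c :: point
  assumes "\<not> collinear {a, b, c}"
  obtains z r where "dist z a = r" "dist z b = r" "dist z c = r" "r > 0"
proof -
  define p q where "p = b - a" and "q = c - a"
  define D where "D = p$1 * q$2 - p$2 * q$1"
  have D: "D \<noteq> 0"
  proof
    assume "D = 0"
    \<comment> \<open>By the identity of Lagrange, \<open>D\<close> squared is the defect in the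
      Cauchy-Schwarz inequality; equality there means collinearity.\<close>
    then have "(p \<bullet> q)\<^sup>2 = (norm p * norm q)\<^sup>2"
      unfolding power_mult_distrib power2_norm_eq_inner inner_real2 D_def by algebra
    then have "\<bar>p \<bullet> q\<bar> = norm p * norm q"
      by (metis abs_of_nonneg norm_ge_zero power2_eq_iff_nonneg power2_abs abs_ge_zero
          mult_nonneg_nonneg)
    then have "collinear {0, p, q}" by (simp add: norm_cauchy_schwarz_equal)
    then have "collinear {b, a, c}" by (simp add: p_def q_def collinear_3[of b a c])
    with assms show False by (simp add: insert_commute)
  qed
  \<comment> \<open>Relative to \<open>a\<close>, the centre solves the linear system
    \<open>2 * (x \<bullet> p) = p \<bullet> p\<close>,
    \<open>2 * (x \<bullet> q) = q \<bullet> q\<close>; this is its solution by Cramer's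
    rule.\<close>
  define x :: point where "x = vector [(q$2 * (p \<bullet> p) - p$2 * (q \<bullet> q)) / (2 * D),
      (p$1 * (q \<bullet> q) - q$1 * (p \<bullet> p)) / (2 * D)]"
  have x1: "2 * D * x$1 = q$2 * (p \<bullet> p) - p$2 * (q \<bullet> q)"
    and x2: "2 * D * x$2 = p$1 * (q \<bullet> q) - q$1 * (p \<bullet> p)"
    using D by (simp_all add: x_def)
  have "D * (2 * (x \<bullet> p)) = D * (p \<bullet> p)" "D * (2 * (x \<bullet> q)) = D * (q \<bullet> q)"
    using x1 x2 unfolding inner_real2 D_def by algebra+
  then have xp: "2 * (x \<bullet> p) = p \<bullet> p" and xq: "2 * (x \<bullet> q) = q \<bullet> q"
    using D by simp_all
  have "norm (x - p) = norm x" "norm (x - q) = norm x"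
    using xp xq by (auto simp: norm_eq inner_diff_left inner_diff_right inner_commute)
  moreover have "a + x - b = x - p" "a + x - c = x - q"
    by (simp_all add: p_def q_def)
  moreover have "x \<noteq> 0"
    using xp D by (auto simp: D_def)
  ultimately show ?thesis
    by (intro that[of "a + x" "norm x"])
      (simp_all only: dist_norm zero_less_norm_iff add_diff_cancel_left' simp_thms not_False_eq_True)
qed

text \<open>A side is a face of the triangle in the sense of convexity, and a proper one because it
  omits \<open>c\<close>; proper faces miss the interior.\<close>

lemma triangle_side_disjoint_interior:
  assumes "\<not> collinear {a, b, c}"
  shows "closed_segment a b \<inter> open_triangle a b c = {}"
proof -
  have "convex hull {a, b} face_of convex hull {a, b, c}"
    using assms by (subst face_of_convex_hull_affine_independent)
      (auto simp: collinear_3_eq_affine_dependent intro: exI[of _ "{a, b}"])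
  moreover have "c \<notin> convex hull {a, b}"
    using assms by (metis between_mem_convex_hull between_imp_collinear insert_commute)
  then have "convex hull {a, b} \<noteq> convex hull {a, b, c}"
    by (metis hull_inc insertI1 insert_commute)
  ultimately show ?thesis
    unfolding open_triangle_def segment_convex_hull by (rule face_of_disjoint_interior)
qed

text \<open>Weak inequalities at the vertices suffice: the interior of a closed half-plane is the
  open one, so the open triangle lies strictly on its side.\<close>

lemma affine_separation:
  fixes k :: point
  assumes "k \<noteq> 0" "k \<bullet> v \<le> d" "k \<bullet> w \<le> d" "k \<bullet> a \<ge> d" "k \<bullet> b \<ge> d" "k \<bullet> c \<ge> d"
  shows "open_segment v w \<inter> open_triangle a b c = {}"
proof -
  have "open_segment v w \<subseteq> convex hull {v, w}"
    by (metis segment_convex_hull segment_open_subset_closed)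
  also have "\<dots> \<subseteq> {x. k \<bullet> x \<le> d}"
    using assms by (intro hull_minimal convex_halfspace_le) auto
  finally have "open_segment v w \<subseteq> {x. k \<bullet> x \<le> d}" .
  moreover have "convex hull {a, b, c} \<subseteq> {x. k \<bullet> x \<ge> d}"
    using assms by (intro hull_minimal convex_halfspace_ge) auto
  then have "open_triangle a b c \<subseteq> {x. k \<bullet> x > d}"
    unfolding open_triangle_def using interior_mono interior_halfspace_ge[OF assms(1)] by blast
  ultimately show ?thesis by fastforce
qed

text \<open>The quadratic term in \<open>x\<close> cancels; for distinct centres the level sets are
  parallel to the radical axis.\<close>

lemma power_difference:
  fixes x y z :: point
  shows "(dist z x)\<^sup>2 - (dist y x)\<^sup>2 = (2 *\<^sub>R (y - z)) \<bullet> x + (z \<bullet> z - y \<bullet> y)"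
  by (simp add: dist_norm power2_norm_eq_inner inner_diff_left inner_diff_right
      inner_commute algebra_simps)

lemma open_segment_subset_ball:
  fixes v w z :: point
  assumes "dist z v = r" "dist z w = r"
  shows "open_segment v w \<subseteq> ball z r"
proof
  fix x assume "x \<in> open_segment v w"
  then show "x \<in> ball z r"
    using dist_decreases_open_segment[of x v w z] assms by auto
qed

text \<open>Discs are strictly convex: two contact points would put the chord between them both in
  \<open>s\<close> and in the open disc.\<close>

lemma contact_unique:
  fixes v w z :: point
  assumes "convex s" "ball z r \<inter> s = {}" "v \<in> s" "w \<in> s" "dist z v = r" "dist z w = r"
  shows "v = w"
proof (rule ccontr)
  assume "v \<noteq> w"
  then have "midpoint v w \<in> open_segment v w" by simp
  moreover have "open_segment v w \<subseteq> s"
    using assms by (meson convex_contains_open_segment)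
  ultimately show False using open_segment_subset_ball[OF assms(5,6)] assms(2) by blast
qed

section \<open>Chords of empty discs in the Delaunay triangulation\<close>

lemma chord_disjoint_face:
  assumes seg: "\<forall>s\<in>S. is_segment s" and gp: "general_position S"
    and F: "segment_delaunay_triangulation S F" and T: "T \<in> F"
    and st: "s \<in> S" "t \<in> S" "s \<noteq> t" "v \<in> s" "w \<in> t"
    and D: "dist z v = r" "dist z w = r" "r > 0" "ball z r \<inter> \<Union>S = {}"
  shows "open_segment v w \<inter> T = {}"
proof -
  have "is_face S T"
    using F T by (auto simp: segment_delaunay_triangulation_def segment_triangulation_def)
  then obtain a b c s1 s2 s3 where abc: "\<not> collinear {a, b, c}" "T = open_triangle a b c"
    and S3: "s1 \<in> S" "s2 \<in> S" "s3 \<in> S" "s1 \<noteq> s2" "s1 \<noteq> s3" "s2 \<noteq> s3" "a \<in> s1" "b \<in> s2" "c \<in> s3"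
    unfolding is_face_def by blast
  obtain y q where y: "dist y a = q" "dist y b = q" "dist y c = q" "q > 0"
    using exists_circumcentre[OF abc(1)] .
  have emp: "ball y q \<inter> \<Union>S = {}"
    using F T abc y unfolding segment_delaunay_triangulation_def by blast
  \<comment> \<open>Chosen so that \<open>k \<bullet> x - d\<close> is the power of \<open>x\<close>
    with respect to the given disc minus its power with respect to the circumcircle.\<close>
  define k d where "k = 2 *\<^sub>R (y - z)" and "d = r\<^sup>2 - q\<^sup>2 - (z \<bullet> z - y \<bullet> y)"
  have h: "k \<bullet> x - d = ((dist z x)\<^sup>2 - r\<^sup>2) - ((dist y x)\<^sup>2 - q\<^sup>2)" for x
    using power_difference[of z x y] by (simp add: k_def d_def)
  have outside: "r\<^sup>2 \<le> (dist z x)\<^sup>2" "q\<^sup>2 \<le> (dist y x)\<^sup>2" if "x \<in> \<Union>S" for x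
  proof -
    have "x \<notin> ball z r" "x \<notin> ball y q" using that D(4) emp by blast+
    then show "r\<^sup>2 \<le> (dist z x)\<^sup>2" "q\<^sup>2 \<le> (dist y x)\<^sup>2" using D y by (auto intro: power_mono)
  qed
  \<comment> \<open>The points \<open>v\<close> and \<open>w\<close> have power zero for the given
    disc and, as points of sites, nonnegative power for the empty circumcircle. For the vertices in
    \<open>tri\<close> the roles are exchanged.\<close>
  have vw: "k \<bullet> v \<le> d" "k \<bullet> w \<le> d"
  proof -
    have "q\<^sup>2 \<le> (dist y v)\<^sup>2" "q\<^sup>2 \<le> (dist y w)\<^sup>2"
      using outside(2) st by blast+
    then show "k \<bullet> v \<le> d" "k \<bullet> w \<le> d" using h[of v] h[of w] D by simp_all
  qed
  have tri: "k \<bullet> a \<ge> d" "k \<bullet> b \<ge> d" "k \<bullet> c \<ge> d"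
  proof -
    have "r\<^sup>2 \<le> (dist z a)\<^sup>2" "r\<^sup>2 \<le> (dist z b)\<^sup>2" "r\<^sup>2 \<le> (dist z c)\<^sup>2"
      using outside(1) S3 by blast+
    then show "k \<bullet> a \<ge> d" "k \<bullet> b \<ge> d" "k \<bullet> c \<ge> d"
      using h[of a] h[of b] h[of c] y by simp_all
  qed
  show ?thesis
  proof (cases "k = 0")
    case False
    then show ?thesis using affine_separation vw tri abc by blast
  next
    case True
    \<comment> \<open>For \<open>k = 0\<close> the bounds \<open>vw\<close> and \<open>tri\<close>
      squeeze \<open>d\<close> to zero: the circles are concentric with equal radii.\<close>
    then have "y = z" "d = 0" using vw tri by (auto simp: k_def)
    then have "y = z" "q = r"
      using y D by (auto simp: d_def)
    note y = y[unfolded this]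
    have tan: "tangent z r u" if "u \<in> S" "x \<in> u" "dist z x = r" for u x
      using that D unfolding tangent_def by auto
    \<comment> \<open>Any other site touching the circle would be a fourth tangent segment, against
      general position.\<close>
    have three: "u \<in> {s1, s2, s3}" if u: "u \<in> S" "x \<in> u" "dist z x = r" for u x
    proof (rule ccontr)
      assume "u \<notin> {s1, s2, s3}"
      then have "card {u, s1, s2, s3} = 4" using S3 by auto
      moreover have "{u, s1, s2, s3} \<subseteq> S" using u S3 by auto
      moreover have "\<forall>s\<in>{u, s1, s2, s3}. tangent z r s"
        using tan u S3 y by blast
      ultimately show False using gp D(3) unfolding general_position_def by blast
    qed
    have uniq: "x = x'" if "u \<in> S" "x \<in> u" "x' \<in> u" "dist z x = r" "dist z x' = r" for u x x'
    proof (rule contact_unique)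
      show "convex u" using seg that unfolding is_segment_def by auto
      show "ball z r \<inter> u = {}" using D that by blast
    qed (use that in auto)
    have contact: "(u = s1 \<and> x = a) \<or> (u = s2 \<and> x = b) \<or> (u = s3 \<and> x = c)"
      if "u \<in> S" "x \<in> u" "dist z x = r" for u x
      using three[OF that] uniq[of u x] that S3 y by blast
    have sides: "closed_segment a b \<inter> T = {}" "closed_segment b c \<inter> T = {}"
      "closed_segment a c \<inter> T = {}"
      using triangle_side_disjoint_interior[of a b c] triangle_side_disjoint_interior[of b c a]
        triangle_side_disjoint_interior[of a c b] abc by (simp_all add: open_triangle_def insert_commute)
    \<comment> \<open>As \<open>s\<close> and \<open>t\<close> differ, \<open>v\<close> and
      \<open>w\<close> are two different vertices of the face, so the chord is one of its
      sides.\<close>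
    then have "closed_segment v w \<inter> T = {}"
      using contact[of s v] contact[of t w] st D by (auto simp: closed_segment_commute)
    then show ?thesis using segment_open_subset_closed by blast
  qed
qed

lemma empty_disc_imp_triangulation_graph:
  assumes seg: "\<forall>s\<in>S. is_segment s" and disj: "pairwise disjnt S" and gp: "general_position S"
    and F: "segment_delaunay_triangulation S F"
    and st: "s \<in> S" "t \<in> S" "s \<noteq> t" "v \<in> s" "w \<in> t"
    and D: "dist z v = r" "dist z w = r" "r > 0" "ball z r \<inter> \<Union>S = {}"
  shows "{s, t} \<in> triangulation_graph S F"
proof -
  have "disjnt s t" using disj st by (auto simp: pairwise_def)
  then have "v \<noteq> w" using st by (auto simp: disjnt_iff)
  let ?X = "convex hull (\<Union>S) - (\<Union>F \<union> \<Union>S)"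
  have "open_segment v w \<inter> \<Union>F = {}"
    using chord_disjoint_face[OF seg gp F _ st D] by blast
  moreover have "open_segment v w \<inter> \<Union>S = {}"
    using open_segment_subset_ball[OF D(1,2)] D(4) by blast
  moreover have "open_segment v w \<subseteq> convex hull (\<Union>S)"
    using st by (meson UnionI convex_contains_open_segment convex_convex_hull hull_inc)
  ultimately have sub: "open_segment v w \<subseteq> ?X" by blast
  \<comment> \<open>A witness that the chord is nonempty, so that a component contains it.\<close>
  have "midpoint v w \<in> open_segment v w" using \<open>v \<noteq> w\<close> by simp
  then obtain e where e: "e \<in> components ?X" "open_segment v w \<subseteq> e"
    using exists_component_superset[OF sub] convex_connected convex_open_segment
    by (metis empty_iff subset_empty sub)
  \<comment> \<open>The component avoids the sites, but its closure reaches them at the ends of the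
    chord.\<close>
  have "{v, w} \<subseteq> closure (open_segment v w)"
    using \<open>v \<noteq> w\<close> by (simp add: closure_open_segment)
  also have "\<dots> \<subseteq> closure e" using e by (intro closure_mono)
  finally show ?thesis
    using e st unfolding triangulation_graph_def triangulation_edges_def by blast
qed

section \<open>From Gabriel edges to empty touching discs\<close>

lemma touching_disc:
  fixes v w :: point
  assumes s: "closed s" "v \<in> s" and t: "closed t" "w \<in> t" and "s \<inter> t = {}"
  obtains z r a b where "a \<in> s" "b \<in> t" "dist z a = r" "dist z b = r" "r > 0"
    "ball z r \<inter> s = {}" "ball z r \<inter> t = {}" "ball z r \<subseteq> ball (midpoint v w) (dist v w / 2)"
proof -
  define g where "g = (\<lambda>l. infdist (linepath v w l) s - infdist (linepath v w l) t)"
  have "continuous_on {0..1} g"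
    unfolding g_def linepath_def by (intro continuous_intros)
  \<comment> \<open>At \<open>v\<close> the distance to \<open>s\<close> vanishes, at
    \<open>w\<close> the distance to \<open>t\<close>; hence the sign change.\<close>
  moreover have "g 0 \<le> 0" "g 1 \<ge> 0"
    using s t by (simp_all add: g_def infdist_nonneg linepath_def)
  ultimately obtain l where l: "0 \<le> l" "l \<le> 1" "g l = 0"
    using IVT'[of g 0 0 1] by auto
  define z r where "z = linepath v w l" and "r = infdist z s"
  have rt: "r = infdist z t" using l by (simp add: g_def z_def r_def)
  obtain a b where a: "a \<in> s" "dist z a = r" and b: "b \<in> t" "dist z b = r"
    using infdist_attains_inf[of s z] infdist_attains_inf[of t z] s t r_def rt by (metis empty_iff)
  have "r > 0"
  proof -
    have "r \<ge> 0" using a by auto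
    moreover have "r \<noteq> 0" using a b \<open>s \<inter> t = {}\<close> by auto
    ultimately show ?thesis by simp
  qed
  have "dist z v = l * dist v w" "dist z w = (1 - l) * dist v w"
    and zm: "dist (midpoint v w) z = \<bar>l - 1/2\<bar> * dist v w"
  proof -
    have "z - v = l *\<^sub>R (w - v)" "z - w = (1 - l) *\<^sub>R (v - w)"
      "z - midpoint v w = (l - 1/2) *\<^sub>R (w - v)"
      by (simp_all add: z_def linepath_def midpoint_def vec_eq_iff field_simps)
    then show "dist z v = l * dist v w" "dist z w = (1 - l) * dist v w"
      "dist (midpoint v w) z = \<bar>l - 1/2\<bar> * dist v w"
      using l by (simp_all add: dist_norm norm_minus_commute[of v w] norm_minus_commute[of _ z])
  qed
  then have "r \<le> l * dist v w" "r \<le> (1 - l) * dist v w"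
    using infdist_le[OF s(2), of z] infdist_le[OF t(2), of z] r_def rt by simp_all
  \<comment> \<open>The radius is at most the smaller of \<open>l\<close> and \<open>1 - l\<close>
    times \<open>dist v w\<close>, and that smaller number plus \<open>\<bar>l - 1/2\<bar>\<close>
    is one half.\<close>
  then have "dist (midpoint v w) z + r \<le> dist v w / 2"
    unfolding zm by (cases "l \<ge> 1/2") (auto simp: algebra_simps)
  then have "ball z r \<subseteq> ball (midpoint v w) (dist v w / 2)"
    using disc_nested[of ball z "midpoint v w"] by (simp add: dist_commute algebra_simps)
  moreover have "ball z r \<inter> s = {}" "ball z r \<inter> t = {}"
    using infdist_le[of _ s z] infdist_le[of _ t z] r_def rt by force+
  ultimately show ?thesis using that a b \<open>r > 0\<close> by blast
qed

lemma gabriel_subset_delaunay: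
  assumes seg: "\<forall>s\<in>S. is_segment s" and disj: "pairwise disjnt S" and gp: "general_position S"
    and disc: "disc = ball \<or> disc = cball"
    and F: "segment_delaunay_triangulation S F"
  shows "gabriel_graph disc S \<subseteq> triangulation_graph S F"
proof
  fix e assume "e \<in> gabriel_graph disc S"
  then obtain s t v w where e: "e = {s, t}" and st: "s \<in> S" "t \<in> S" "s \<noteq> t" "v \<in> s" "w \<in> t"
    and emp: "\<forall>u \<in> S - {s, t}. u \<inter> disc (midpoint v w) (dist v w / 2) = {}"
    unfolding gabriel_graph_def lune_skeleton_def skeleton_def lune_one by blast
  have cl: "closed s" "closed t"
    using seg st unfolding is_segment_def by auto
  have "s \<inter> t = {}"
    using disj st by (auto simp: pairwise_def disjnt_def)
  from touching_disc[OF cl(1) st(4) cl(2) st(5) this] obtain z r a b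
    where zr: "a \<in> s" "b \<in> t" "dist z a = r" "dist z b = r" "r > 0"
      "ball z r \<inter> s = {}" "ball z r \<inter> t = {}"
      "ball z r \<subseteq> ball (midpoint v w) (dist v w / 2)" .
  have "ball (midpoint v w) (dist v w / 2) \<subseteq> disc (midpoint v w) (dist v w / 2)"
    using disc ball_subset_cball by auto
  \<comment> \<open>The segments \<open>s\<close> and \<open>t\<close> may enter the diametral disc,
    but the touching ball avoids them by construction; all others miss the diametral disc.\<close>
  then have "ball z r \<inter> \<Union>S = {}"
    using zr emp by blast
  then show "e \<in> triangulation_graph S F"
    unfolding e
    using empty_disc_imp_triangulation_graph[OF seg disj gp F st(1-3) zr(1-5)] by simp
qed

theorem theorem1:
  fixes S :: "point set set"
    and disc :: "point \<Rightarrow> real \<Rightarrow> point set"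
    and \<beta> \<beta>' :: real
  assumes "finite S"
    and "\<forall>s\<in>S. is_segment s"
    and "pairwise disjnt S"
    and "general_position S"
    and "disc = ball \<or> disc = cball"
    and "1 \<le> \<beta>" and "\<beta> < \<beta>'"
  shows "gabriel_graph disc S = circle_skeleton disc 1 S \<and>
    lune_skeleton disc \<beta>' S \<subseteq> lune_skeleton disc \<beta> S \<and>
    lune_skeleton disc \<beta> S \<subseteq> gabriel_graph disc S \<and>
    circle_skeleton disc \<beta>' S \<subseteq> circle_skeleton disc \<beta> S \<and>
    circle_skeleton disc \<beta> S \<subseteq> gabriel_graph disc S \<and>
    (\<forall>F. segment_delaunay_triangulation S F \<longrightarrow>
       gabriel_graph disc S \<subseteq> triangulation_graph S F)"
proof (intro conjI allI impI)
  show "gabriel_graph disc S = circle_skeleton disc 1 S"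
    by (simp add: gabriel_graph_def lune_skeleton_def circle_skeleton_def skeleton_def lune_one
        two_discs_one)
  then show "circle_skeleton disc \<beta> S \<subseteq> gabriel_graph disc S"
    using skeleton_antimono[OF two_discs_mono] assms by (simp add: circle_skeleton_def)
  show "circle_skeleton disc \<beta>' S \<subseteq> circle_skeleton disc \<beta> S"
    using skeleton_antimono[OF two_discs_mono] assms by (simp add: circle_skeleton_def)
  show "lune_skeleton disc \<beta>' S \<subseteq> lune_skeleton disc \<beta> S"
    using skeleton_antimono[OF lune_mono] assms by (simp add: lune_skeleton_def)
  show "lune_skeleton disc \<beta> S \<subseteq> gabriel_graph disc S"
    using skeleton_antimono[OF lune_mono] assms by (simp add: lune_skeleton_def gabriel_graph_def)
  show "gabriel_graph disc S \<subseteq> triangulation_graph S F" if "segment_delaunay_triangulation S F" for F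
    using gabriel_subset_delaunay assms that by blast
qed

end
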